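(* For each prime $p$ let $\mathbb{G}_p$ be the prime field of order $p$, regarded as a meadow by setting $0^{-1}=0$. Then the minimal subalgebra of the direct product $\prod_{p\text{ prime}}\mathbb{G}_p$ is an initial object in the category of meadows.
   Context: The signature of meadows has constants $0,1$, unary operations $-$ and ${}^{-1}$, and binary operations $+$ and $\cdot$. A meadow is an algebra of this signature satisfying the set $\mathit{Md}$ of equations consisting of the axioms of commutative rings with multiplicative identity, $(x+y)+z=x+(y+z)$, $x+y=y+x$, $x+0=x$, $x+(-x)=0$, $(x\cdot y)\cdot z=x\cdot(y\cdot z)$, $x\cdot y=y\cdot x$, $x\cdot 1=x$, $x\cdot(y+z)=x\cdot y+x\cdot z$, together with reflection $(x^{-1})^{-1}=x$ and the restricted inverse law $x\cdot(x\cdot x^{-1})=x$. Homomorphisms of meadows preserve all constants and operations of the signature. Any field becomes a meadow (a zero-totalized field) by setting $0^{-1}=0$. Direct products are taken with coordinatewise operations. The minimal subalgebra of an algebra is its smallest subalgebra, i.e. the set of denotations of closed terms over the signature. *)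

theory Defs
  imports "HOL-Number_Theory.Residues"
begin

section \<open>Meadows\<close>

text \<open>
  The signature: a ring record of HOL-Algebra together with the two unary operations, which are
  genuine operations of the structure (and not the derived \<^const>\<open>a_inv\<close> and \<^const>\<open>m_inv\<close>).
\<close>

record 'a meadow_alg = "'a ring" +
  mneg :: "'a \<Rightarrow> 'a"
  minv :: "'a \<Rightarrow> 'a"

definition subuniverse :: "('a, 'm) meadow_alg_scheme \<Rightarrow> 'a set \<Rightarrow> bool"
  where "subuniverse A S \<longleftrightarrow>
    S \<subseteq> carrier A \<and>
    zero A \<in> S \<and> one A \<in> S \<and>
    (\<forall>x\<in>S. mneg A x \<in> S) \<and> (\<forall>x\<in>S. minv A x \<in> S) \<and>
    (\<forall>x\<in>S. \<forall>y\<in>S. add A x y \<in> S) \<and> (\<forall>x\<in>S. \<forall>y\<in>S. monoid.mult A x y \<in> S)"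

locale signature_algebra =
  fixes A (structure)
  assumes zero_closed: "\<zero> \<in> carrier A"
    and one_closed: "\<one> \<in> carrier A"
    and mneg_closed: "x \<in> carrier A \<Longrightarrow> mneg A x \<in> carrier A"
    and minv_closed: "x \<in> carrier A \<Longrightarrow> minv A x \<in> carrier A"
    and add_closed: "\<lbrakk>x \<in> carrier A; y \<in> carrier A\<rbrakk> \<Longrightarrow> x \<oplus> y \<in> carrier A"
    and mult_closed: "\<lbrakk>x \<in> carrier A; y \<in> carrier A\<rbrakk> \<Longrightarrow> x \<otimes> y \<in> carrier A"

locale meadow = signature_algebra +
  assumes add_assoc:
      "\<lbrakk>x \<in> carrier A; y \<in> carrier A; z \<in> carrier A\<rbrakk> \<Longrightarrow> (x \<oplus> y) \<oplus> z = x \<oplus> (y \<oplus> z)"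
    and add_comm: "\<lbrakk>x \<in> carrier A; y \<in> carrier A\<rbrakk> \<Longrightarrow> x \<oplus> y = y \<oplus> x"
    and add_zero: "x \<in> carrier A \<Longrightarrow> x \<oplus> \<zero> = x"
    and add_mneg: "x \<in> carrier A \<Longrightarrow> x \<oplus> mneg A x = \<zero>"
    and mult_assoc:
      "\<lbrakk>x \<in> carrier A; y \<in> carrier A; z \<in> carrier A\<rbrakk> \<Longrightarrow> (x \<otimes> y) \<otimes> z = x \<otimes> (y \<otimes> z)"
    and mult_comm: "\<lbrakk>x \<in> carrier A; y \<in> carrier A\<rbrakk> \<Longrightarrow> x \<otimes> y = y \<otimes> x"
    and mult_one: "x \<in> carrier A \<Longrightarrow> x \<otimes> \<one> = x"
    and distrib:
      "\<lbrakk>x \<in> carrier A; y \<in> carrier A; z \<in> carrier A\<rbrakk> \<Longrightarrow> x \<otimes> (y \<oplus> z) = x \<otimes> y \<oplus> x \<otimes> z"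
    and reflection: "x \<in> carrier A \<Longrightarrow> minv A (minv A x) = x"
    and restricted_inverse: "x \<in> carrier A \<Longrightarrow> x \<otimes> (x \<otimes> minv A x) = x"

text \<open>
  Homomorphisms are normalised to be undefined outside the carrier of the source, so that equality
  of HOL functions is equality of maps between the carriers.
\<close>

definition meadow_hom ::
    "('a, 'm) meadow_alg_scheme \<Rightarrow> ('b, 'n) meadow_alg_scheme \<Rightarrow> ('a \<Rightarrow> 'b) set"
  where "meadow_hom A B = {h \<in> carrier A \<rightarrow>\<^sub>E carrier B.
    h (zero A) = zero B \<and> h (one A) = one B \<and>
    (\<forall>x\<in>carrier A. h (mneg A x) = mneg B (h x)) \<and>
    (\<forall>x\<in>carrier A. h (minv A x) = minv B (h x)) \<and>
    (\<forall>x\<in>carrier A. \<forall>y\<in>carrier A. h (add A x y) = add B (h x) (h y)) \<and>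
    (\<forall>x\<in>carrier A. \<forall>y\<in>carrier A. h (monoid.mult A x y) = monoid.mult B (h x) (h y))}"


section \<open>Zero-totalized fields and products\<close>

definition zero_totalized :: "('a, 'm) ring_scheme \<Rightarrow> 'a meadow_alg"
  where "zero_totalized R =
    \<lparr>carrier = carrier R, monoid.mult = monoid.mult R, one = one R, zero = zero R, add = add R,
     mneg = (\<lambda>x. \<ominus>\<^bsub>R\<^esub> x),
     minv = (\<lambda>x. if x = \<zero>\<^bsub>R\<^esub> then \<zero>\<^bsub>R\<^esub> else inv\<^bsub>R\<^esub> x)\<rparr>"

definition prime_field_meadow :: "nat \<Rightarrow> int meadow_alg"
  where "prime_field_meadow p = zero_totalized (residue_ring (int p))"

definition product_alg :: "'i set \<Rightarrow> ('i \<Rightarrow> ('a, 'm) meadow_alg_scheme) \<Rightarrow> ('i \<Rightarrow> 'a) meadow_alg"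
  where "product_alg I F =
    \<lparr>carrier = (\<Pi>\<^sub>E i\<in>I. carrier (F i)),
     monoid.mult = (\<lambda>x y. \<lambda>i\<in>I. x i \<otimes>\<^bsub>F i\<^esub> y i),
     one = (\<lambda>i\<in>I. \<one>\<^bsub>F i\<^esub>),
     zero = (\<lambda>i\<in>I. \<zero>\<^bsub>F i\<^esub>),
     add = (\<lambda>x y. \<lambda>i\<in>I. x i \<oplus>\<^bsub>F i\<^esub> y i),
     mneg = (\<lambda>x. \<lambda>i\<in>I. mneg (F i) (x i)),
     minv = (\<lambda>x. \<lambda>i\<in>I. minv (F i) (x i))\<rparr>"

lemma (in field) meadow_zero_totalized: "meadow (zero_totalized R)"
proof -
  have U: "inv x \<in> carrier R" "inv x \<noteq> \<zero>" "inv (inv x) = x" "x \<otimes> inv x = \<one>"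
    if "x \<in> carrier R" "x \<noteq> \<zero>" for x
  proof -
    have x: "x \<in> Units R"
      using that field_Units by auto
    show "inv x \<in> carrier R" "inv (inv x) = x" "x \<otimes> inv x = \<one>"
      using x by simp_all
    show "inv x \<noteq> \<zero>"
      using Units_inv_Units[OF x] field_Units by auto
  qed
  show ?thesis
    by unfold_locales
      (auto simp: zero_totalized_def U a_ac m_ac r_distr r_neg)
qed

lemma meadow_prime_field: "prime p \<Longrightarrow> meadow (prime_field_meadow p)"
proof -
  assume "prime p"
  then interpret residues_prime p "residue_ring (int p)"
    by unfold_locales auto
  show ?thesis
    unfolding prime_field_meadow_def by (rule meadow_zero_totalized)
qed

lemma meadow_product_alg:
  assumes "\<And>i. i \<in> I \<Longrightarrow> meadow (F i)"
  shows "meadow (product_alg I F)"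
proof -
  note closed = signature_algebra.zero_closed signature_algebra.one_closed
    signature_algebra.mneg_closed signature_algebra.minv_closed
    signature_algebra.add_closed signature_algebra.mult_closed
  note axioms = meadow.add_assoc meadow.add_comm meadow.add_zero meadow.add_mneg
    meadow.mult_assoc meadow.mult_comm meadow.mult_one meadow.distrib
    meadow.reflection meadow.restricted_inverse
  show ?thesis
    by unfold_locales
      (auto simp: product_alg_def PiE_iff fun_eq_iff restrict_def extensional_def
        intro: axioms[OF assms] closed[OF meadow.axioms(1)[OF assms]])
qed


section \<open>Minimal subalgebras\<close>

definition minimal_subalgebra :: "'a meadow_alg \<Rightarrow> 'a meadow_alg"
  where "minimal_subalgebra A = A\<lparr>carrier := \<Inter>{S. subuniverse A S}\<rparr>"

datatype cterm = Zero | One | Neg cterm | Inv cterm | Plus cterm cterm | Times cterm cterm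

primrec denotation :: "('a, 'm) meadow_alg_scheme \<Rightarrow> cterm \<Rightarrow> 'a"
  where
    "denotation A Zero = zero A"
  | "denotation A One = one A"
  | "denotation A (Neg t) = mneg A (denotation A t)"
  | "denotation A (Inv t) = minv A (denotation A t)"
  | "denotation A (Plus s t) = add A (denotation A s) (denotation A t)"
  | "denotation A (Times s t) = monoid.mult A (denotation A s) (denotation A t)"

lemma carrier_minimal_subalgebra:
  assumes "signature_algebra A"
  shows "carrier (minimal_subalgebra A) = range (denotation A)"
proof -
  interpret signature_algebra A
    by (fact assms)
  have "denotation A t \<in> S" if "subuniverse A S" for t S
    using that by (induction t) (auto simp: subuniverse_def)
  moreover have "subuniverse A (range (denotation A))"
  proof -
    have "denotation A t \<in> carrier A" for t
      by (induction t)
        (auto intro: zero_closed one_closed mneg_closed minv_closed add_closed mult_closed)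
    then show ?thesis
      unfolding subuniverse_def
      by (auto simp flip: denotation.simps)
  qed
  ultimately show ?thesis
    by (auto simp: minimal_subalgebra_def)
qed

end

theory Submission
  imports Defs "HOL-Decision_Procs.Algebra_Aux"
begin

text \<open>
  The minimal subalgebra of a product consists of the denotations of closed terms, so a homomorphism
  from it to a meadow $M$ can only send the denotation of \<open>t\<close> to the denotation of \<open>t\<close> in $M$. This
  prescription is a well-defined homomorphism as soon as two closed terms that have the same value in
  all prime fields have the same value in every meadow. Passing to the difference of the two terms,
  it is enough that a closed term \<open>t\<close> vanishing in all prime fields vanishes in every meadow
  (\<open>denotation_eq_zero\<close>).

  A classical argument would embed $M$ into a product of fields, and treat the fields of positive
  characteristic and those of characteristic zero apart. The proof below carries out both cases
  inside $M$ itself, with neither maximal ideals nor quotients.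

  Characteristic zero: evaluated in the zero-totalized field of rational numbers, \<open>t\<close> is a fraction
  $a / N$ of integers. In every meadow $N^2 t = N a$ (\<open>denom_denotation\<close>): this is the equation
  $t = a / N$, multiplied by a power of $N$ because $N$ need not be invertible. Apply it in the
  prime fields: as \<open>t\<close> vanishes there, every prime divides $N a$, hence $a = 0$. So $N^2 t = 0$ in
  $M$.

  Characteristic $p$: on an element $u$ with $p u = 0$ the term \<open>t\<close> acts by multiplication with
  its value in the field of order $p$ (\<open>torsion_denotation\<close>), and hence as zero.

  The two cases are joined by induction on the prime factorization of $n = N^2$. If
  $(p n) t = 0$, then $u = n t$ is killed by $p$, so $n t^2 = u t = 0$, and the restricted inverse
  law cancels one factor: $n t = n t^2 t^{-1} = 0$. When no prime factor is left, $t = 0$.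
\<close>

section \<open>Meadows as commutative rings\<close>

sublocale meadow \<subseteq> cring A
proof -
  have zero_add: "\<zero> \<oplus> x = x" and one_mult: "\<one> \<otimes> x = x" if "x \<in> carrier A" for x
    using that add_comm[of \<zero> x] add_zero[of x] mult_comm[of \<one> x] mult_one[of x]
    by (simp_all add: zero_closed one_closed)
  have neg: "\<exists>y\<in>carrier A. y \<oplus> x = \<zero>" if "x \<in> carrier A" for x
    using that add_mneg[of x] mneg_closed[of x] add_comm[of x "mneg A x"] by auto
  have l_distr: "(x \<oplus> y) \<otimes> z = x \<otimes> z \<oplus> y \<otimes> z"
    if "x \<in> carrier A" "y \<in> carrier A" "z \<in> carrier A" for x y z
    using that distrib[of z x y] mult_comm[of z] by (simp add: add_closed)
  show "cring A"
    by (intro cringI abelian_groupI comm_monoidI)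
      (rule zero_closed one_closed add_closed mult_closed add_assoc add_comm mult_assoc mult_comm
        zero_add one_mult neg l_distr; assumption)+
qed

context meadow
begin

lemma mneg_eq_a_inv: "x \<in> carrier A \<Longrightarrow> mneg A x = \<ominus> x"
  using minus_equality[of "mneg A x" x] add_mneg[of x] mneg_closed[of x] add_comm[of x "mneg A x"]
  by simp

text \<open>The restricted inverse law at \<open>minv A x\<close>, whose inverse is \<open>x\<close> by reflection.\<close>

lemma minv_restricted_inverse: "x \<in> carrier A \<Longrightarrow> x \<otimes> minv A x \<otimes> minv A x = minv A x"
  using restricted_inverse[of "minv A x"]
  by (simp add: reflection minv_closed m_ac)

lemma mult_minv_eq_zero:
  assumes "u \<in> carrier A" "x \<in> carrier A" "u \<otimes> x = \<zero>"
  shows "u \<otimes> minv A x = \<zero>"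
proof -
  have "u \<otimes> minv A x = u \<otimes> x \<otimes> (minv A x \<otimes> minv A x)"
    using assms(1,2) minv_restricted_inverse[of x] by (simp add: minv_closed m_assoc)
  then show ?thesis
    using assms by (simp add: minv_closed)
qed

text \<open>Meadows are reduced: a square can be undone by one multiplication with the inverse.\<close>

lemma mult_square_eq_zero:
  assumes "u \<in> carrier A" "x \<in> carrier A" "u \<otimes> (x \<otimes> x) = \<zero>"
  shows "u \<otimes> x = \<zero>"
proof -
  have "u \<otimes> x = u \<otimes> (x \<otimes> x) \<otimes> minv A x"
    using assms(1,2) restricted_inverse[of x] by (simp add: minv_closed m_assoc)
  then show ?thesis
    using assms by (simp add: minv_closed)
qed

lemma denotation_closed: "denotation A t \<in> carrier A"
  by (induction t)
    (auto intro: zero_closed one_closed mneg_closed minv_closed add_closed mult_closed)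

end

section \<open>Rational values of closed terms\<close>

text \<open>
  An unreduced fraction for the value of a closed term in the zero-totalized field of rational
  numbers. The denominator may become negative; only its being nonzero matters.
\<close>

fun numer :: "cterm \<Rightarrow> int" and denom :: "cterm \<Rightarrow> int" where
  "numer Zero = 0"
| "numer One = 1"
| "numer (Neg t) = - numer t"
| "numer (Inv t) = (if numer t = 0 then 0 else denom t * denom t)"
| "numer (Plus s t) = numer s * denom t + numer t * denom s"
| "numer (Times s t) = numer s * numer t"
| "denom Zero = 1"
| "denom One = 1"
| "denom (Neg t) = denom t"
| "denom (Inv t) = (if numer t = 0 then denom t else denom t * numer t)"
| "denom (Plus s t) = denom s * denom t"
| "denom (Times s t) = denom s * denom t"

lemma denom_nonzero: "denom t \<noteq> 0"
  by (induction t) auto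

context meadow
begin

text \<open>
  The plain equation $N t = a$ does not hold in general: for $t = p^{-1}$ it would say
  $p p^{-1} = 1$, which fails in characteristic $p$. With a further factor $N$ on both sides it is
  preserved by all operations. For the inverse the point is that
  $N a \cdot t t^{-1} = N^2 t \cdot t t^{-1} = N^2 t = N a$, so that $t t^{-1}$ acts as the identity
  on $N a$.
\<close>

lemma denom_denotation:
  "\<guillemotleft>denom t\<guillemotright> \<otimes> \<guillemotleft>denom t\<guillemotright> \<otimes> denotation A t = \<guillemotleft>denom t\<guillemotright> \<otimes> \<guillemotleft>numer t\<guillemotright>"
proof (induction t)
  case (Neg t)
  then show ?case by (simp add: mneg_eq_a_inv denotation_closed r_minus)
next
  case (Plus s t)
  define n m a b x y where d: "n = \<guillemotleft>denom s\<guillemotright>" "m = \<guillemotleft>denom t\<guillemotright>" "a = \<guillemotleft>numer s\<guillemotright>" "b = \<guillemotleft>numer t\<guillemotright>"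
    "x = denotation A s" "y = denotation A t"
  have c: "n \<in> carrier A" "m \<in> carrier A" "a \<in> carrier A" "b \<in> carrier A" "x \<in> carrier A" "y \<in> carrier A"
    by (auto simp: d denotation_closed)
  have "(n \<otimes> m) \<otimes> (n \<otimes> m) \<otimes> (x \<oplus> y) = (m \<otimes> m) \<otimes> (n \<otimes> n \<otimes> x) \<oplus> (n \<otimes> n) \<otimes> (m \<otimes> m \<otimes> y)"
    using c by (simp add: r_distr m_ac)
  also have "\<dots> = (m \<otimes> m) \<otimes> (n \<otimes> a) \<oplus> (n \<otimes> n) \<otimes> (m \<otimes> b)"
    using Plus.IH by (simp add: d)
  also have "\<dots> = (n \<otimes> m) \<otimes> (a \<otimes> m \<oplus> b \<otimes> n)"
    using c by (simp add: r_distr m_ac)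
  finally show ?case by (simp add: d)
next
  case (Times s t)
  define n m a b x y where d: "n = \<guillemotleft>denom s\<guillemotright>" "m = \<guillemotleft>denom t\<guillemotright>" "a = \<guillemotleft>numer s\<guillemotright>" "b = \<guillemotleft>numer t\<guillemotright>"
    "x = denotation A s" "y = denotation A t"
  have c: "n \<in> carrier A" "m \<in> carrier A" "a \<in> carrier A" "b \<in> carrier A" "x \<in> carrier A" "y \<in> carrier A"
    by (auto simp: d denotation_closed)
  have "(n \<otimes> m) \<otimes> (n \<otimes> m) \<otimes> (x \<otimes> y) = (n \<otimes> n \<otimes> x) \<otimes> (m \<otimes> m \<otimes> y)"
    using c by (simp add: m_ac)
  also have "\<dots> = (n \<otimes> a) \<otimes> (m \<otimes> b)"
    using Times.IH by (simp add: d)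
  also have "\<dots> = (n \<otimes> m) \<otimes> (a \<otimes> b)"
    using c by (simp add: m_ac)
  finally show ?case by (simp add: d)
next
  case (Inv t)
  define n a x where d: "n = \<guillemotleft>denom t\<guillemotright>" "a = \<guillemotleft>numer t\<guillemotright>" "x = denotation A t"
  have c: "n \<in> carrier A" "a \<in> carrier A" "x \<in> carrier A" "minv A x \<in> carrier A"
    by (auto simp: d denotation_closed minv_closed)
  have IH: "n \<otimes> n \<otimes> x = n \<otimes> a"
    using Inv.IH by (simp add: d)
  show ?case
  proof (cases "numer t = 0")
    case True
    then have "n \<otimes> n \<otimes> minv A x = \<zero>"
      using c IH by (intro mult_minv_eq_zero) (auto simp: d)
    then show ?thesis
      using True by (simp add: d)
  next
    case False
    have absorb: "n \<otimes> a \<otimes> (x \<otimes> minv A x) = n \<otimes> a"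
    proof -
      have "n \<otimes> a \<otimes> (x \<otimes> minv A x) = n \<otimes> n \<otimes> (x \<otimes> (x \<otimes> minv A x))"
        using c by (simp add: IH[symmetric] m_ac)
      then show ?thesis
        using c by (simp add: restricted_inverse IH)
    qed
    have "(n \<otimes> a) \<otimes> (n \<otimes> a) \<otimes> minv A x = (n \<otimes> n \<otimes> x) \<otimes> minv A x \<otimes> (n \<otimes> a)"
      using c unfolding IH by (simp add: m_ac)
    also have "\<dots> = (n \<otimes> n) \<otimes> (n \<otimes> a \<otimes> (x \<otimes> minv A x))"
      using c by (simp add: m_ac)
    also have "\<dots> = (n \<otimes> a) \<otimes> (n \<otimes> n)"
      using c unfolding absorb by (simp add: m_ac)
    finally show ?thesis
      using False by (simp add: d)
  qed
qed auto

end

section \<open>Values of closed terms in prime fields\<close>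

lemma prime_field_meadow_simps:
  "carrier (prime_field_meadow p) = {0..int p - 1}"
  "zero (prime_field_meadow p) = 0"
  "one (prime_field_meadow p) = 1"
  "add (prime_field_meadow p) x y = (x + y) mod int p"
  "monoid.mult (prime_field_meadow p) x y = x * y mod int p"
  by (simp_all add: prime_field_meadow_def zero_totalized_def residue_ring_def)

lemma of_integer_prime_field:
  assumes "prime p"
  shows "of_integer (prime_field_meadow p) k = k mod int p"
proof -
  interpret meadow "prime_field_meadow p"
    by (rule meadow_prime_field[OF assms])
  have p: "1 < int p"
    using assms prime_gt_1_nat by force
  interpret R: residues "int p" "residue_ring (int p)"
    using p by unfold_locales auto
  have nat: "of_natural (prime_field_meadow p) n = int n mod int p" for n
    using p by (induction n)
      (auto simp: prime_field_meadow_simps mod_simps)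
  have neg: "a_inv (prime_field_meadow p) x = - x mod int p" if "x \<in> {0..int p - 1}" for x
    using that mneg_eq_a_inv[of x]
    by (auto simp: prime_field_meadow_def zero_totalized_def R.res_neg_eq R.res_carrier_eq)
  show ?thesis
    using p by (auto simp: of_integer_def nat neg mod_simps)
qed

lemma of_integer_prime_field_eq_zero_iff:
  assumes "prime p"
  shows "of_integer (prime_field_meadow p) k = zero (prime_field_meadow p) \<longleftrightarrow> int p dvd k"
  by (simp add: of_integer_prime_field[OF assms] prime_field_meadow_simps mod_eq_0_iff_dvd)

text \<open>
  If the fraction $a / N$ is nonzero, some prime exceeds $|N a|$ and hence does not divide it, but by
  \<open>denom_denotation\<close> the number $N a$ is zero in every prime field in which the term vanishes.
\<close>

lemma numer_eq_zero:
  assumes "\<And>p. prime p \<Longrightarrow> denotation (prime_field_meadow p) t = zero (prime_field_meadow p)"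
  shows "numer t = 0"
proof (rule ccontr)
  assume nz: "numer t \<noteq> 0"
  define k where "k = denom t * numer t"
  have k: "k \<noteq> 0"
    using nz denom_nonzero by (simp add: k_def)
  obtain p where p: "prime p" "nat \<bar>k\<bar> < p"
    using bigger_prime by blast
  interpret meadow "prime_field_meadow p"
    by (rule meadow_prime_field[OF p(1)])
  have "of_integer (prime_field_meadow p) k = zero (prime_field_meadow p)"
    using denom_denotation[of t] assms[OF p(1)] by (simp add: k_def)
  then have "int p dvd k"
    using of_integer_prime_field_eq_zero_iff p(1) by blast
  then have "int p \<le> \<bar>k\<bar>"
    using k by (meson abs_ge_zero dvd_abs_iff zdvd_imp_le zero_less_abs_iff)
  then show False
    using p(2) by linarith
qed

context meadow
begin

lemma torsion_of_int_cong:
  assumes "u \<in> carrier A" "u \<otimes> \<guillemotleft>m\<guillemotright> = \<zero>" "[i = j] (mod m)"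
  shows "u \<otimes> \<guillemotleft>i\<guillemotright> = u \<otimes> \<guillemotleft>j\<guillemotright>"
proof -
  obtain k where "j = i + m * k"
    using assms(3) cong_iff_lin by blast
  then have "u \<otimes> \<guillemotleft>j\<guillemotright> = u \<otimes> \<guillemotleft>i\<guillemotright> \<oplus> u \<otimes> \<guillemotleft>m\<guillemotright> \<otimes> \<guillemotleft>k\<guillemotright>"
    using assms(1) by (simp add: r_distr m_assoc)
  then show ?thesis
    using assms by simp
qed

text \<open>
  The multiples of an element killed by $p$ form a vector space over the field of order $p$, and
  this lemma lets a closed term act on it through its value in that field. In the case of an
  inverse, let $k$ be the value of the term $x$. If $k = 0$, then $u x = 0$ and so
  $u x^{-1} = 0$. Otherwise let $k'$ be the inverse of $k$. As $u x k' = u k k' = u$, the idempotent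
  $x x^{-1}$ fixes $u$, and therefore $u x^{-1} = u x k' x^{-1} = u k'$.
\<close>

lemma torsion_denotation:
  assumes p: "prime p" and u: "u \<in> carrier A" "u \<otimes> \<guillemotleft>int p\<guillemotright> = \<zero>"
  shows "u \<otimes> denotation A t = u \<otimes> \<guillemotleft>denotation (prime_field_meadow p) t\<guillemotright>"
proof (induction t)
  let ?G = "prime_field_meadow p"
  interpret G: meadow ?G
    by (rule meadow_prime_field[OF p])
  have p1: "1 < int p"
    using p prime_gt_1_nat by force
  interpret R: residues "int p" "residue_ring (int p)"
    using p1 by unfold_locales auto
  note G_simps = prime_field_meadow_simps
  note cong = torsion_of_int_cong[OF u]
  {
    case Zero
    show ?case
      by (simp add: G_simps)
  next
    case One
    show ?case
      by (simp add: G_simps)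
  next
    case (Neg t)
    have "u \<otimes> \<guillemotleft>denotation ?G (Neg t)\<guillemotright> = u \<otimes> \<guillemotleft>- denotation ?G t\<guillemotright>"
      by (rule cong) (simp add: prime_field_meadow_def zero_totalized_def R.res_neg_eq)
    then show ?case
      using Neg u(1) by (simp add: mneg_eq_a_inv denotation_closed r_minus)
  next
    case (Plus s t)
    have "u \<otimes> \<guillemotleft>denotation ?G (Plus s t)\<guillemotright> = u \<otimes> \<guillemotleft>denotation ?G s + denotation ?G t\<guillemotright>"
      by (rule cong) (simp add: G_simps)
    then show ?case
      using Plus u(1) by (simp add: denotation_closed r_distr)
  next
    case (Times s t)
    define a b x y where d: "a = \<guillemotleft>denotation ?G s\<guillemotright>" "b = \<guillemotleft>denotation ?G t\<guillemotright>"
      "x = denotation A s" "y = denotation A t"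
    have c: "a \<in> carrier A" "b \<in> carrier A" "x \<in> carrier A" "y \<in> carrier A"
      by (auto simp: d denotation_closed)
    have IH: "u \<otimes> x = u \<otimes> a" "u \<otimes> y = u \<otimes> b"
      using Times by (simp_all add: d)
    have "u \<otimes> (x \<otimes> y) = (u \<otimes> x) \<otimes> y"
      using c u(1) by (simp add: m_assoc)
    also have "\<dots> = (u \<otimes> y) \<otimes> a"
      using c u(1) unfolding IH(1) by (simp add: m_ac)
    also have "\<dots> = u \<otimes> (a \<otimes> b)"
      using c u(1) unfolding IH by (simp add: m_ac)
    also have "\<dots> = u \<otimes> \<guillemotleft>denotation ?G s * denotation ?G t\<guillemotright>"
      by (simp add: d)
    also have "\<dots> = u \<otimes> \<guillemotleft>denotation ?G (Times s t)\<guillemotright>"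
      by (rule cong) (simp add: G_simps)
    finally show ?case
      by (simp add: d)
  next
    case (Inv t)
    define k where "k = denotation ?G t"
    define k' where "k' = minv ?G k"
    define x where "x = denotation A t"
    have c: "x \<in> carrier A" "minv A x \<in> carrier A"
      by (auto simp: x_def denotation_closed minv_closed)
    have IH: "u \<otimes> x = u \<otimes> \<guillemotleft>k\<guillemotright>"
      using Inv by (simp add: x_def k_def)
    have k_carrier: "k \<in> carrier (residue_ring (int p))"
      using G.denotation_closed[of t] by (simp add: k_def prime_field_meadow_def zero_totalized_def)
    show ?case
    proof (cases "k = 0")
      case True
      then have "u \<otimes> minv A x = \<zero>"
        using IH u(1) c by (intro mult_minv_eq_zero) auto
      moreover have "k' = 0"
        using True by (simp add: k'_def prime_field_meadow_def zero_totalized_def R.res_zero_eq)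
      ultimately show ?thesis
        using u(1) by (simp add: x_def k'_def k_def)
    next
      case False
      interpret RP: residues_prime p "residue_ring (int p)"
        using p by unfold_locales auto
      have "k \<in> Units (residue_ring (int p))"
        using False k_carrier RP.field_Units by (simp add: R.res_zero_eq)
      then have "k * k' mod int p = 1"
        using False R.Units_r_inv[of k]
        by (simp add: k'_def prime_field_meadow_def zero_totalized_def R.res_mult_eq
          R.res_one_eq R.res_zero_eq)
      then have "u \<otimes> \<guillemotleft>k * k'\<guillemotright> = u \<otimes> \<guillemotleft>1\<guillemotright>"
        by (intro cong) (use p1 in \<open>simp add: cong_def mod_pos_pos_trivial del: of_nat_less_iff\<close>)
      then have kk': "u \<otimes> \<guillemotleft>k\<guillemotright> \<otimes> \<guillemotleft>k'\<guillemotright> = u"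
        using u(1) by (simp add: m_assoc)
      have unit: "u \<otimes> (x \<otimes> minv A x) = u"
      proof -
        have "u \<otimes> (x \<otimes> minv A x) = u \<otimes> x \<otimes> \<guillemotleft>k'\<guillemotright> \<otimes> (x \<otimes> minv A x)"
          unfolding IH kk' ..
        also have "\<dots> = u \<otimes> (x \<otimes> (x \<otimes> minv A x)) \<otimes> \<guillemotleft>k'\<guillemotright>"
          using c u(1) by (simp add: m_ac)
        also have "\<dots> = u"
          using c by (simp add: restricted_inverse IH kk')
        finally show ?thesis .
      qed
      have "u \<otimes> minv A x = u \<otimes> x \<otimes> \<guillemotleft>k'\<guillemotright> \<otimes> minv A x"
        unfolding IH kk' ..
      also have "\<dots> = u \<otimes> (x \<otimes> minv A x) \<otimes> \<guillemotleft>k'\<guillemotright>"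
        using c u(1) by (simp add: m_ac)
      also have "\<dots> = u \<otimes> \<guillemotleft>k'\<guillemotright>"
        unfolding unit ..
      finally show ?thesis
        by (simp add: x_def k'_def k_def)
    qed
  }
qed

lemma denotation_eq_zero:
  assumes zero: "\<And>p. prime p \<Longrightarrow> denotation (prime_field_meadow p) t = zero (prime_field_meadow p)"
  shows "denotation A t = \<zero>"
proof -
  define x where "x = denotation A t"
  have x: "x \<in> carrier A"
    by (simp add: x_def denotation_closed)
  have strip: "x = \<zero>" if "0 < n" "\<guillemotleft>int n\<guillemotright> \<otimes> x = \<zero>" for n
    using that
  proof (induction n rule: prime_divisors_induct)
    case zero
    then show ?case by simp
  next
    case (unit n)
    then show ?case using x by simp
  next
    case (factor p n)
    define u where "u = \<guillemotleft>int n\<guillemotright> \<otimes> x"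
    have p: "prime p" and u: "u \<in> carrier A" "u \<otimes> \<guillemotleft>int p\<guillemotright> = \<zero>"
      using factor x by (auto simp: u_def m_ac)
    have "u \<otimes> x = u \<otimes> \<guillemotleft>denotation (prime_field_meadow p) t\<guillemotright>"
      unfolding x_def by (rule torsion_denotation[OF p u])
    also have "denotation (prime_field_meadow p) t = 0"
      using zero[OF p] by (simp add: prime_field_meadow_simps)
    finally have "\<guillemotleft>int n\<guillemotright> \<otimes> (x \<otimes> x) = \<zero>"
      using x u by (simp add: u_def m_assoc)
    then have "\<guillemotleft>int n\<guillemotright> \<otimes> x = \<zero>"
      by (rule mult_square_eq_zero[OF of_int_closed x])
    then show ?case
      using factor by simp
  qed
  have "\<guillemotleft>denom t * denom t\<guillemotright> \<otimes> x = \<zero>"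
    using denom_denotation[of t] numer_eq_zero[OF zero] by (simp add: x_def)
  \<comment> \<open>The square is a positive number whatever the sign of the denominator.\<close>
  moreover have "denom t * denom t = int (nat (denom t * denom t))" "0 < nat (denom t * denom t)"
    using denom_nonzero[of t] by (auto simp: zero_less_mult_iff)
  ultimately show ?thesis
    using strip[of "nat (denom t * denom t)"] by (simp only: x_def)
qed

lemma denotation_Plus_Neg_eq_zero_iff:
  "denotation A (Plus s (Neg t)) = \<zero> \<longleftrightarrow> denotation A s = denotation A t"
proof -
  have "denotation A s \<oplus> \<ominus> denotation A t = \<zero> \<longleftrightarrow> denotation A s = denotation A t"
    using r_right_minus_eq[of "denotation A s" "denotation A t"]
    by (simp add: denotation_closed minus_eq)
  then show ?thesis
    by (simp add: mneg_eq_a_inv denotation_closed)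
qed

lemma denotation_eqI:
  assumes "\<And>p. prime p \<Longrightarrow> denotation (prime_field_meadow p) s = denotation (prime_field_meadow p) t"
  shows "denotation A s = denotation A t"
proof -
  have "denotation (prime_field_meadow p) (Plus s (Neg t)) = zero (prime_field_meadow p)"
    if "prime p" for p
    using assms[OF that] meadow.denotation_Plus_Neg_eq_zero_iff[OF meadow_prime_field[OF that]]
    by blast
  then show ?thesis
    using denotation_eq_zero denotation_Plus_Neg_eq_zero_iff by blast
qed

end

section \<open>Initiality of minimal subalgebras\<close>

lemma denotation_product_alg:
  "i \<in> I \<Longrightarrow> denotation (product_alg I F) t i = denotation (F i) t"
  by (induction t) (simp_all add: product_alg_def)

lemma minimal_subalgebra_simps:
  "zero (minimal_subalgebra A) = zero A"
  "one (minimal_subalgebra A) = one A"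
  "mneg (minimal_subalgebra A) = mneg A"
  "minv (minimal_subalgebra A) = minv A"
  "add (minimal_subalgebra A) = add A"
  "monoid.mult (minimal_subalgebra A) = monoid.mult A"
  by (simp_all add: minimal_subalgebra_def)

lemma meadow_subuniverse:
  fixes A :: "'a meadow_alg"
  assumes "meadow A" "subuniverse A S"
  shows "meadow (A\<lparr>carrier := S\<rparr>)"
proof -
  interpret meadow A
    by (fact assms)
  have [simp]: "x \<in> carrier A" if "x \<in> S" for x
    using that assms(2) by (auto simp: subuniverse_def)
  show ?thesis
    by unfold_locales
      (use assms(2) in \<open>simp_all add: subuniverse_def a_ac add_mneg m_ac
        r_distr reflection restricted_inverse\<close>)
qed

lemma subuniverse_carrier_minimal_subalgebra:
  assumes "signature_algebra A"
  shows "subuniverse A (carrier (minimal_subalgebra A))"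
proof -
  interpret signature_algebra A
    by (fact assms)
  have "subuniverse A (carrier A)"
    by (simp add: subuniverse_def zero_closed one_closed mneg_closed minv_closed
      add_closed mult_closed)
  then show ?thesis
    by (auto simp: minimal_subalgebra_def subuniverse_def)
qed

lemma meadow_minimal_subalgebra:
  assumes "meadow A"
  shows "meadow (minimal_subalgebra A)"
  using meadow_subuniverse[OF assms
      subuniverse_carrier_minimal_subalgebra[OF meadow.axioms(1)[OF assms]]]
  by (simp add: minimal_subalgebra_def)

text \<open>
  Homomorphisms commute with the denotation of closed terms, and these exhaust a minimal subalgebra;
  so there is at most one homomorphism, and it exists when the value in \<open>B\<close> depends only on the
  value in \<open>A\<close>.
\<close>

lemma ex1_meadow_hom_minimal_subalgebra:
  assumes A: "signature_algebra A" and B: "meadow B"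
    and eq: "\<And>s t. denotation A s = denotation A t \<Longrightarrow> denotation B s = denotation B t"
  shows "\<exists>!h. h \<in> meadow_hom (minimal_subalgebra A) B"
proof -
  interpret B: meadow B
    by (fact B)
  let ?I = "minimal_subalgebra A"
  note carrier = carrier_minimal_subalgebra[OF A]
  define h where "h = (\<lambda>x\<in>carrier ?I. denotation B (SOME t. denotation A t = x))"
  have h: "h (denotation A t) = denotation B t" for t
  proof -
    have "denotation A (SOME s. denotation A s = denotation A t) = denotation A t"
      by (rule someI) (rule refl)
    from eq[OF this] show ?thesis
      by (simp add: h_def carrier)
  qed
  note h_op = h[of Zero] h[of One] h[of "Neg t" for t] h[of "Inv t" for t]
    h[of "Plus s t" for s t] h[of "Times s t" for s t]
  note h_op = h_op[unfolded denotation.simps]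
  show ?thesis
  proof (rule ex1I)
    show "h \<in> meadow_hom ?I B"
      unfolding meadow_hom_def mem_Collect_eq
    proof (intro conjI)
      show "h \<in> carrier ?I \<rightarrow>\<^sub>E carrier B"
        by (auto simp: carrier h B.denotation_closed) (simp add: h_def carrier)
    qed (auto simp: carrier minimal_subalgebra_simps h h_op)
  next
    fix g assume g: "g \<in> meadow_hom ?I B"
    have "g (denotation A t) = denotation B t" for t
      by (induction t)
        (use g in \<open>auto simp: meadow_hom_def carrier minimal_subalgebra_simps\<close>)
    then have "g x = h x" if "x \<in> carrier ?I" for x
      using that by (auto simp: carrier h)
    moreover have "g \<in> extensional (carrier ?I)" "h \<in> extensional (carrier ?I)"
      using g by (auto simp: meadow_hom_def h_def PiE_def)
    ultimately show "g = h"
      by (intro extensionalityI)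
  qed
qed

theorem theorem2p3:
  fixes I :: "(nat \<Rightarrow> int) meadow_alg"
  assumes "I = minimal_subalgebra (product_alg {p. prime p} prime_field_meadow)"
  shows "meadow I \<and> (\<forall>M :: 'a meadow_alg. meadow M \<longrightarrow> (\<exists>!h. h \<in> meadow_hom I M))"
proof (intro conjI allI impI)
  let ?P = "product_alg {p. prime p} prime_field_meadow"
  have P: "meadow ?P"
    by (rule meadow_product_alg) (simp add: meadow_prime_field)
  then show "meadow I"
    unfolding assms by (rule meadow_minimal_subalgebra)
  fix M :: "'a meadow_alg"
  assume M: "meadow M"
  show "\<exists>!h. h \<in> meadow_hom I M"
    unfolding assms
  proof (rule ex1_meadow_hom_minimal_subalgebra[OF meadow.axioms(1)[OF P] M])
    fix s t assume "denotation ?P s = denotation ?P t"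
    then have "denotation (prime_field_meadow p) s = denotation (prime_field_meadow p) t"
      if "prime p" for p
      using that by (metis denotation_product_alg mem_Collect_eq)
    then show "denotation M s = denotation M t"
      by (rule meadow.denotation_eqI[OF M])
  qed
qed

end
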